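(* Let $\mathscr{H},\mathscr{K}$ be Hilbert spaces and suppose that $\Phi: \mathbb{B}(\mathscr{H}) \to \mathbb{B}(\mathscr{K})$ is a positive linear map such that $\Phi(I)$ is invertible and $\Phi(I)\leq I$. Assume that $A, B \in \mathbb{B}(\mathscr{H})$ are positive invertible operators such that $0<m_1\leq A\leq M_1$ and $0<m_2\leq B\leq M_2$ for some scalars $m_1\leq M_1$ and $m_2\leq M_2$. Then $$\Phi(B^2)^{\frac{1}{2}} \Phi(A^2)\Phi(B^2)^{\frac{1}{2}} - \left| \Phi(B^2)^{-\frac{1}{2}} \Phi(A^2\,\sharp\, B^2) \Phi(B^2)^{\frac{1}{2}} \right|^2 \leq \frac{(M_1M_2-m_1m_2)^2}{4} \times \frac{M_2^2}{m_2^2}$$ and $$\Phi(A^2)^{\frac{1}{2}} \Phi(B^2)\Phi(A^2)^{\frac{1}{2}} - \left| \Phi(A^2)^{-\frac{1}{2}} \Phi(A^2\,\sharp\, B^2) \Phi(A^2)^{\frac{1}{2}} \right|^2 \leq \frac{(M_1M_2-m_1m_2)^2}{4} \times \frac{M_1^2}{m_1^2}.$$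
   Context: $\mathbb{B}(\mathscr{H})$ is the algebra of all bounded linear operators on a Hilbert space $\mathscr{H}$. A scalar $\alpha$ also denotes the operator $\alpha I$. For self-adjoint operators, $B\le A$ means $\langle B\xi,\xi\rangle\le\langle A\xi,\xi\rangle$ for all vectors $\xi$; $A$ is positive if $0\le A$. A linear map $\Phi$ is positive if $\Phi(A)$ is positive whenever $A$ is. For positive operators $A,B$ with $A$ invertible, the geometric operator mean is $A\,\sharp\,B = A^{1/2}\left(A^{-1/2}BA^{-1/2}\right)^{1/2}A^{1/2}$. For an operator $X$, $|X|=(X^*X)^{1/2}$, so $|X|^2=X^*X$. *)

theory Defs
  imports "HOL-Analysis.Analysis"
begin

class complex_vector = real_vector +
  fixes scaleC :: "complex \<Rightarrow> 'a \<Rightarrow> 'a"  (infixr "*\<^sub>C" 75)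
  assumes scaleC_add_right: "a *\<^sub>C (x + y) = a *\<^sub>C x + a *\<^sub>C y"
    and scaleC_add_left: "(a + b) *\<^sub>C x = a *\<^sub>C x + b *\<^sub>C x"
    and scaleC_scaleC: "a *\<^sub>C b *\<^sub>C x = (a * b) *\<^sub>C x"
    and scaleC_one: "1 *\<^sub>C x = x"
    and scaleC_of_real: "complex_of_real r *\<^sub>C x = r *\<^sub>R x"

text \<open>The inner product is linear in its first argument; positive definiteness is contained in
  \<open>cinner_self\<close> together with the norm axioms.\<close>

class complex_inner = complex_vector + real_normed_vector +
  fixes cinner :: "'a \<Rightarrow> 'a \<Rightarrow> complex"
  assumes cinner_commute: "cinner x y = cnj (cinner y x)"
    and cinner_add_left: "cinner (x + y) z = cinner x z + cinner y z"
    and cinner_scaleC_left: "cinner (a *\<^sub>C x) y = a * cinner x y"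
    and cinner_self: "cinner x x = complex_of_real ((norm x)\<^sup>2)"

class complex_hilbert = complex_inner + complete_space

definition clinear :: "('a::complex_vector \<Rightarrow> 'b::complex_vector) \<Rightarrow> bool" where
  "clinear f \<longleftrightarrow> (\<forall>x y. f (x + y) = f x + f y) \<and> (\<forall>c x. f (c *\<^sub>C x) = c *\<^sub>C f x)"

lemma scaleC_zero_right [simp]: "c *\<^sub>C (0 :: 'a::complex_vector) = 0"
  using scaleC_add_right[of c "0 :: 'a" 0] by simp

lemma norm_scaleC: "norm (c *\<^sub>C (x :: 'a::complex_inner)) = cmod c * norm x"
proof -
  have "cinner (c *\<^sub>C x) (c *\<^sub>C x) = c * cnj c * cinner x x"
    by (metis (no_types, lifting) cinner_commute cinner_scaleC_left complex_cnj_mult mult.assoc)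
  also have "\<dots> = complex_of_real ((cmod c * norm x)\<^sup>2)"
    by (simp add: cinner_self power_mult_distrib flip: complex_norm_square)
  finally have "(norm (c *\<^sub>C x))\<^sup>2 = (cmod c * norm x)\<^sup>2"
    unfolding cinner_self of_real_eq_iff .
  then show ?thesis
    by (rule power2_eq_imp_eq) auto
qed

lemma bounded_linear_scaleC: "bounded_linear (\<lambda>x :: 'a::complex_inner. c *\<^sub>C x)"
  by (rule bounded_linear_intro[where K = "cmod c"])
     (simp_all add: scaleC_add_right scaleC_scaleC norm_scaleC mult.commute flip: scaleC_of_real)

typedef (overloaded) 'a bounded_op = "{f :: 'a::complex_inner \<Rightarrow> 'a. clinear f \<and> bounded_linear f}"
  morphisms op_apply Bounded_op
  by (rule exI[of _ "\<lambda>x. x"]) (simp add: clinear_def bounded_linear_ident)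

setup_lifting type_definition_bounded_op

text \<open>Multiplication is composition. The type is not an instance of \<open>ring_1\<close>, since \<open>0 = 1\<close>
  on the zero space; powers come from \<open>monoid_mult\<close>.\<close>

instantiation bounded_op :: (complex_inner) "{complex_vector, ring, monoid_mult}"
begin

lift_definition zero_bounded_op :: "'a bounded_op" is "\<lambda>x. 0"
  by (simp add: clinear_def bounded_linear_zero)

lift_definition one_bounded_op :: "'a bounded_op" is "\<lambda>x. x"
  by (simp add: clinear_def bounded_linear_ident)

lift_definition plus_bounded_op :: "'a bounded_op \<Rightarrow> 'a bounded_op \<Rightarrow> 'a bounded_op"
  is "\<lambda>f g x. f x + g x"
  by (simp add: clinear_def bounded_linear_add scaleC_add_right add.assoc add.left_commute)

lift_definition scaleC_bounded_op :: "complex \<Rightarrow> 'a bounded_op \<Rightarrow> 'a bounded_op"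
  is "\<lambda>c f x. c *\<^sub>C f x"
  by (simp add: clinear_def scaleC_add_right scaleC_scaleC mult.commute
      bounded_linear_compose[OF bounded_linear_scaleC])

lift_definition times_bounded_op :: "'a bounded_op \<Rightarrow> 'a bounded_op \<Rightarrow> 'a bounded_op"
  is "\<lambda>f g x. f (g x)"
  by (simp add: clinear_def bounded_linear_compose)

definition scaleR_bounded_op :: "real \<Rightarrow> 'a bounded_op \<Rightarrow> 'a bounded_op" where
  "scaleR_bounded_op r A = complex_of_real r *\<^sub>C A"

definition uminus_bounded_op :: "'a bounded_op \<Rightarrow> 'a bounded_op" where
  "uminus_bounded_op A = (- 1) *\<^sub>C A"

definition minus_bounded_op :: "'a bounded_op \<Rightarrow> 'a bounded_op \<Rightarrow> 'a bounded_op" where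
  "minus_bounded_op A B = A + - B"

instance
proof
  fix a b c :: "'a bounded_op" and r s :: real and z w :: complex
  have m1: "(- 1) *\<^sub>C x = - x" for x :: 'a
    using scaleC_of_real[of "- 1" x] by simp
  show "a + b + c = a + (b + c)" by transfer (simp add: add.assoc)
  show "a + b = b + a" by transfer (simp add: add.commute)
  show "0 + a = a" by transfer simp
  show "- a + a = 0" unfolding uminus_bounded_op_def by transfer (simp add: m1)
  show "a - b = a + - b" by (rule minus_bounded_op_def)
  show "a * b * c = a * (b * c)" by transfer simp
  show "(a + b) * c = a * c + b * c" by transfer simp
  show "a * (b + c) = a * b + a * c" by transfer (simp add: clinear_def)
  show "1 * a = a" by transfer simp
  show "a * 1 = a" by transfer simp
  show "z *\<^sub>C (a + b) = z *\<^sub>C a + z *\<^sub>C b" by transfer (simp add: scaleC_add_right)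
  show "(z + w) *\<^sub>C a = z *\<^sub>C a + w *\<^sub>C a" by transfer (simp add: scaleC_add_left)
  show "z *\<^sub>C w *\<^sub>C a = (z * w) *\<^sub>C a" by transfer (simp add: scaleC_scaleC)
  show 4: "1 *\<^sub>C a = a" by transfer (simp add: scaleC_one)
  show "complex_of_real r *\<^sub>C a = r *\<^sub>R a" by (simp add: scaleR_bounded_op_def)
  have 1: "z *\<^sub>C (a + b) = z *\<^sub>C a + z *\<^sub>C b" for z by transfer (simp add: scaleC_add_right)
  have 2: "(z + w) *\<^sub>C a = z *\<^sub>C a + w *\<^sub>C a" for z w by transfer (simp add: scaleC_add_left)
  have 3: "z *\<^sub>C w *\<^sub>C a = (z * w) *\<^sub>C a" for z w by transfer (simp add: scaleC_scaleC)
  show "r *\<^sub>R (a + b) = r *\<^sub>R a + r *\<^sub>R b" by (simp add: scaleR_bounded_op_def 1)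
  show "(r + s) *\<^sub>R a = r *\<^sub>R a + s *\<^sub>R a" by (simp add: scaleR_bounded_op_def 2)
  show "r *\<^sub>R s *\<^sub>R a = (r * s) *\<^sub>R a" by (simp add: scaleR_bounded_op_def 3)
  show "1 *\<^sub>R a = a" by (simp add: scaleR_bounded_op_def 4)
qed

end

text \<open>The definite descriptions below are meaningful by standard uniqueness results: the adjoint
  exists uniquely on a Hilbert space (Riesz), inverses of invertible operators are unique, and a
  positive operator on a Hilbert space has exactly one positive square root.\<close>

definition op_adj :: "'a::complex_inner bounded_op \<Rightarrow> 'a bounded_op" where
  "op_adj A = (THE S. \<forall>x y. cinner (op_apply A x) y = cinner x (op_apply S y))"

definition selfadjoint :: "'a::complex_inner bounded_op \<Rightarrow> bool" where
  "selfadjoint A \<longleftrightarrow> op_adj A = A"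

text \<open>For self-adjoint operators the quadratic forms are real, so comparing real parts is comparing
  the forms themselves.\<close>

definition op_le :: "'a::complex_inner bounded_op \<Rightarrow> 'a bounded_op \<Rightarrow> bool"  (infix "\<preceq>" 50) where
  "B \<preceq> A \<longleftrightarrow> selfadjoint B \<and> selfadjoint A \<and>
     (\<forall>\<xi>. Re (cinner (op_apply B \<xi>) \<xi>) \<le> Re (cinner (op_apply A \<xi>) \<xi>))"

definition positive_op :: "'a::complex_inner bounded_op \<Rightarrow> bool" where
  "positive_op A \<longleftrightarrow> 0 \<preceq> A"

definition invertible_op :: "'a::complex_inner bounded_op \<Rightarrow> bool" where
  "invertible_op A \<longleftrightarrow> (\<exists>S. A * S = 1 \<and> S * A = 1)"

definition op_inv :: "'a::complex_inner bounded_op \<Rightarrow> 'a bounded_op" where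
  "op_inv A = (THE S. A * S = 1 \<and> S * A = 1)"

definition op_sqrt :: "'a::complex_inner bounded_op \<Rightarrow> 'a bounded_op" where
  "op_sqrt A = (THE S. positive_op S \<and> S * S = A)"

definition op_abs :: "'a::complex_inner bounded_op \<Rightarrow> 'a bounded_op" where
  "op_abs X = op_sqrt (op_adj X * X)"

definition op_mean :: "'a::complex_inner bounded_op \<Rightarrow> 'a bounded_op \<Rightarrow> 'a bounded_op"
    (infixl "\<sharp>" 70) where
  "A \<sharp> B = op_sqrt A * op_sqrt (op_inv (op_sqrt A) * B * op_inv (op_sqrt A)) * op_sqrt A"

definition positive_map ::
    "('a::complex_inner bounded_op \<Rightarrow> 'b::complex_inner bounded_op) \<Rightarrow> bool" where
  "positive_map \<Phi> \<longleftrightarrow> (\<forall>A. positive_op A \<longrightarrow> positive_op (\<Phi> A))"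

end

theory Submission
  imports Defs
begin

text \<open>The operator \<open>X = (A\<^sup>-\<^sup>1 B\<^sup>2 A\<^sup>-\<^sup>1)\<^sup>1\<^sup>/\<^sup>2\<close> has spectrum in \<open>[m2 / M1, M2 / m1]\<close>; multiplying
  \<open>(X - m2 / M1) (M2 / m1 - X) \<ge> 0\<close> by \<open>A\<close> on both sides gives the Diaz--Metcalf inequality
  \<open>m1 M1 B\<^sup>2 + m2 M2 A\<^sup>2 \<le> (m1 m2 + M1 M2) (A\<^sup>2 \<sharp> B\<^sup>2)\<close>, which \<open>\<Phi>\<close> preserves. It bounds
  \<open>\<Phi>(A\<^sup>2)\<close> by a combination of \<open>\<Phi>(A\<^sup>2 \<sharp> B\<^sup>2)\<close> and \<open>\<Phi>(B\<^sup>2)\<close>, and completing the square leaves a multiple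
  of \<open>\<Phi>(B\<^sup>2)\<^sup>2 \<le> M2\<^sup>4\<close>. The Diaz--Metcalf inequality is symmetric, so the second claim needs no
  symmetry of the mean.\<close>

text \<open>This makes the bounded real-linear maps \<open>'a \<Rightarrow>\<^sub>L 'a\<close> a
  complete space, in which square roots will be found as fixed points.\<close>

instance complex_hilbert \<subseteq> banach ..

section \<open>The inner product\<close>

lemma scaleC_scaleR: "c *\<^sub>C r *\<^sub>R x = r *\<^sub>R c *\<^sub>C (x :: 'a::complex_vector)"
  by (metis scaleC_scaleC scaleC_of_real mult.commute)

lemma cinner_add_right: "cinner x (y + z) = cinner x y + cinner x (z :: 'a::complex_inner)"
  by (metis cinner_add_left cinner_commute complex_cnj_add)

lemma cinner_scaleC_right: "cinner x (a *\<^sub>C y) = cnj a * cinner x (y :: 'a::complex_inner)"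
  by (metis cinner_commute cinner_scaleC_left complex_cnj_mult)

lemma cinner_scaleR_left: "cinner (r *\<^sub>R x) y = of_real r * cinner x (y :: 'a::complex_inner)"
  by (metis cinner_scaleC_left scaleC_of_real)

lemma cinner_scaleR_right: "cinner x (r *\<^sub>R y) = of_real r * cinner x (y :: 'a::complex_inner)"
  by (metis cinner_scaleC_right scaleC_of_real complex_cnj_complex_of_real)

lemma cinner_minus_left: "cinner (- x) y = - cinner x (y :: 'a::complex_inner)"
  using cinner_scaleR_left[of "-1" x y] by simp

lemma cinner_minus_right: "cinner x (- y) = - cinner x (y :: 'a::complex_inner)"
  using cinner_scaleR_right[of x "-1" y] by simp

lemma cinner_diff_left: "cinner (x - y) z = cinner x z - cinner y (z :: 'a::complex_inner)"
  using cinner_add_left[of x "- y" z] by (simp add: cinner_minus_left)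

lemma cinner_diff_right: "cinner x (y - z) = cinner x y - cinner x (z :: 'a::complex_inner)"
  using cinner_add_right[of x y "- z"] by (simp add: cinner_minus_right)

lemma cinner_zero_left [simp]: "cinner 0 (y :: 'a::complex_inner) = 0"
  using cinner_scaleR_left[of 0 0 y] by simp

lemma cinner_zero_right [simp]: "cinner (x :: 'a::complex_inner) 0 = 0"
  using cinner_scaleR_right[of x 0 0] by simp

section \<open>Norm identities and the Cauchy-Schwarz inequality\<close>

lemma Re_cinner_self: "Re (cinner x x) = (norm (x :: 'a::complex_inner))\<^sup>2"
  by (simp add: cinner_self)

lemma Re_cinner_commute: "Re (cinner x y) = Re (cinner y (x :: 'a::complex_inner))"
  by (subst cinner_commute) simp

lemma norm_add_power2:
  "(norm (x + y))\<^sup>2 = (norm x)\<^sup>2 + 2 * Re (cinner x y) + (norm (y :: 'a::complex_inner))\<^sup>2"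
  by (simp add: cinner_add_left cinner_add_right Re_cinner_commute[of y x] flip: Re_cinner_self)

lemma norm_diff_power2:
  "(norm (x - y))\<^sup>2 = (norm x)\<^sup>2 - 2 * Re (cinner x y) + (norm (y :: 'a::complex_inner))\<^sup>2"
  using norm_add_power2[of x "- y"] by (simp add: cinner_minus_right)

text \<open>For c > 0, evaluate at the minimiser t = -b/c; for c = 0, an affine function that is
  nonnegative everywhere is constant. Both Cauchy-Schwarz arguments and the first-order condition in
  the Riesz theorem use this.\<close>

lemma discriminant_nonpos:
  fixes a b c :: real
  assumes "\<And>t. 0 \<le> a + 2 * t * b + t\<^sup>2 * c" and "0 \<le> c"
  shows "b\<^sup>2 \<le> a * c"
proof (cases "c = 0")
  case True
  have "b = 0"
  proof (rule ccontr)
    assume "b \<noteq> 0"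
    \<comment> \<open>The chosen t gives a + 2 t b = -1.\<close>
    then show False
      using assms(1)[of "- (a + 1) / (2 * b)"] True by (simp add: field_simps)
  qed
  then show ?thesis using True by simp
next
  case False
  then have "c > 0" using assms(2) by simp
  then show ?thesis
    using assms(1)[of "- b / c"] by (simp add: field_simps power2_eq_square)
qed

lemma Re_cinner_le_norm: "\<bar>Re (cinner x y)\<bar> \<le> norm x * norm (y :: 'a::complex_inner)"
proof -
  have "(Re (cinner x y))\<^sup>2 \<le> (norm x)\<^sup>2 * (norm y)\<^sup>2"
  proof (rule discriminant_nonpos)
    fix t
    have "0 \<le> (norm (x + t *\<^sub>R y))\<^sup>2" by simp
    then show "0 \<le> (norm x)\<^sup>2 + 2 * t * Re (cinner x y) + t\<^sup>2 * (norm y)\<^sup>2"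
      unfolding norm_add_power2 by (simp add: cinner_scaleR_right power_mult_distrib)
  qed simp
  then show ?thesis
    by (metis abs_le_square_iff abs_mult abs_norm_cancel power_mult_distrib)
qed

lemma cmod_cinner_le_norm: "cmod (cinner x y) \<le> norm x * norm (y :: 'a::complex_inner)"
proof (cases "cinner x y = 0")
  case False
  \<comment> \<open>Scaling x by the conjugate of the inner product makes the product real and
    nonnegative, so the bound on real parts suffices.\<close>
  have "(cmod (cinner x y))\<^sup>2 = Re (cinner (cnj (cinner x y) *\<^sub>C x) y)"
    by (simp add: cinner_scaleC_left cmod_power2) (simp add: power2_eq_square)
  also have "\<dots> \<le> cmod (cinner x y) * (norm x * norm y)"
    using Re_cinner_le_norm[of "cnj (cinner x y) *\<^sub>C x" y] by (simp add: norm_scaleC)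
  finally show ?thesis using False by (simp add: power2_eq_square)
qed simp

lemma bounded_linear_cinner_left: "bounded_linear (\<lambda>x. cinner x (y :: 'a::complex_inner))"
  by (rule bounded_linear_intro[where K = "norm y"])
     (simp_all add: cinner_add_left cinner_scaleR_left cmod_cinner_le_norm scaleR_conv_of_real)

lemma bounded_linear_cinner_right: "bounded_linear (\<lambda>y. cinner x (y :: 'a::complex_inner))"
  by (rule bounded_linear_intro[where K = "norm x"])
     (simp_all add: cinner_add_right cinner_scaleR_right scaleR_conv_of_real
       cmod_cinner_le_norm[of x, unfolded mult.commute[of "norm x"]])

lemma cinner_eqI:
  assumes "\<And>x. cinner x y = cinner x (z :: 'a::complex_inner)"
  shows "y = z"
proof -
  have "cinner (y - z) (y - z) = 0"
    by (simp add: cinner_diff_right assms)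
  then show ?thesis by (simp add: cinner_self)
qed

text \<open>The representing vector minimises \<open>\<parallel>x\<parallel>\<^sup>2 - 2 Re (f x)\<close>; minimising sequences are Cauchy by the
  parallelogram law.\<close>

lemma riesz_representation:
  fixes f :: "'a::complex_hilbert \<Rightarrow> complex"
  assumes f: "bounded_linear f" and fC: "\<And>c x. f (c *\<^sub>C x) = c * f x"
  obtains z where "\<And>x. f x = cinner x z"
proof -
  interpret f: bounded_linear f by (rule f)
  define J where "J x = (norm x)\<^sup>2 - 2 * Re (f x)" for x
  obtain K where K: "\<And>x. norm (f x) \<le> norm x * K" using f.bounded by blast
  have below: "- K\<^sup>2 \<le> J x" for x
  proof -
    have "Re (f x) \<le> norm x * K" using K[of x] complex_Re_le_cmod[of "f x"] by linarith
    moreover have "0 \<le> (norm x - K)\<^sup>2" by simp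
    ultimately show ?thesis unfolding J_def by (simp add: power2_diff)
  qed
  define d where "d = Inf (range J)"
  have bdd: "bdd_below (range J)" using below by (meson bdd_belowI2)
  have d_le: "d \<le> J x" for x unfolding d_def by (rule cInf_lower[OF _ bdd]) simp
  have "\<exists>x. J x < d + 1 / Suc n" for n
    using cInf_lessD[of "range J" "d + 1 / Suc n"] unfolding d_def by auto
  then obtain u where u: "\<And>n. J (u n) < d + 1 / Suc n" by metis
  have par: "(norm (x - y))\<^sup>2 \<le> 2 * (J x - d) + 2 * (J y - d)" for x y
  proof -
    \<comment> \<open>In the parallelogram law for J the linear parts cancel, and the midpoint has J
      at least d.\<close>
    have "4 * J ((1 / 2) *\<^sub>R (x + y)) + (norm (x - y))\<^sup>2 = 2 * J x + 2 * J y"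
      unfolding J_def norm_scaleR power_mult_distrib norm_add_power2 norm_diff_power2 f.scaleR f.add
      by (simp add: field_simps power2_eq_square)
    with d_le[of "(1 / 2) *\<^sub>R (x + y)"] show ?thesis by simp
  qed
  have "Cauchy u"
  proof (rule metric_CauchyI)
    fix e :: real assume "0 < e"
    then obtain N where N: "4 / e\<^sup>2 < real (Suc N)"
      by (metis reals_Archimedean2 less_trans of_nat_less_iff lessI)
    show "\<exists>M. \<forall>m\<ge>M. \<forall>n\<ge>M. dist (u m) (u n) < e"
    proof (intro exI allI impI)
      fix m n assume mn: "N \<le> m" "N \<le> n"
      have "J (u k) < d + 1 / Suc N" if "N \<le> k" for k
      proof -
        have "1 / real (Suc k) \<le> 1 / real (Suc N)" using that by (simp add: frac_le)
        then show ?thesis using u[of k] by linarith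
      qed
      from this[OF mn(1)] this[OF mn(2)]
      have "(norm (u m - u n))\<^sup>2 < 4 * (1 / Suc N)"
        using par[of "u m" "u n"] by argo
      also have "\<dots> < e\<^sup>2" using N \<open>0 < e\<close> by (simp add: field_simps)
      finally show "dist (u m) (u n) < e"
        unfolding dist_norm using \<open>0 < e\<close> by (simp add: power_less_imp_less_base)
    qed
  qed
  then obtain z where z: "u \<longlonglongrightarrow> z" using Cauchy_convergent convergent_def by blast
  have "(\<lambda>n. J (u n)) \<longlonglongrightarrow> J z"
    unfolding J_def by (intro tendsto_intros f.tendsto z)
  moreover have "(\<lambda>n. d + 1 / Suc n) \<longlonglongrightarrow> d"
    using LIMSEQ_inverse_real_of_nat_add[of d] by (simp add: inverse_eq_divide)
  ultimately have "J z \<le> d"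
    by (rule LIMSEQ_le) (use u less_imp_le in blast)
  then have min: "J z \<le> J x" for x using d_le order_trans by blast
  have Re_eq: "Re (f x) = Re (cinner x z)" for x
  proof -
    \<comment> \<open>First-order condition at the minimiser: J (z + t x) - J z is a nonnegative
      quadratic in t without constant term, so its linear coefficient vanishes.\<close>
    have "(Re (cinner x z) - Re (f x))\<^sup>2 \<le> 0 * (norm x)\<^sup>2"
    proof (rule discriminant_nonpos)
      fix t
      have "J (z + t *\<^sub>R x) = J z + 2 * t * (Re (cinner x z) - Re (f x)) + t\<^sup>2 * (norm x)\<^sup>2"
        unfolding J_def norm_add_power2 f.add f.scaleR
        by (simp add: cinner_scaleR_right Re_cinner_commute[of z x] power_mult_distrib algebra_simps)
      with min[of "z + t *\<^sub>R x"]
      show "0 \<le> 0 + 2 * t * (Re (cinner x z) - Re (f x)) + t\<^sup>2 * (norm x)\<^sup>2" by simp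
    qed simp
    then show ?thesis by simp
  qed
  \<comment> \<open>Replacing x by i x turns the equality of real parts into that of imaginary
    parts.\<close>
  have "f x = cinner x z" for x
    using Re_eq[of x] Re_eq[of "\<i> *\<^sub>C x"]
    by (simp add: fC cinner_scaleC_left complex_eq_iff)
  then show thesis by (rule that)
qed

section \<open>Bounded operators and adjoints\<close>

lemmas op_apply_times [simp] = times_bounded_op.rep_eq
lemmas op_apply_one [simp] = one_bounded_op.rep_eq
lemmas op_apply_zero [simp] = zero_bounded_op.rep_eq
lemmas op_apply_plus [simp] = plus_bounded_op.rep_eq

lemma op_apply_scaleR [simp]: "op_apply (r *\<^sub>R A) x = r *\<^sub>R op_apply A x"
  unfolding scaleR_bounded_op_def scaleC_bounded_op.rep_eq by (rule scaleC_of_real)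

lemma op_apply_minus [simp]: "op_apply (A - B) x = op_apply A x - op_apply B x"
  by (metis op_apply_plus diff_add_cancel add_diff_cancel_right')

lemma bounded_op_eqI: "(\<And>x. op_apply A x = op_apply B x) \<Longrightarrow> A = B"
  by (metis ext op_apply_inject)

lemma bounded_linear_op_apply: "bounded_linear (op_apply A)"
  using op_apply[of A] by simp

lemma op_apply_scaleC: "op_apply A (c *\<^sub>C x) = c *\<^sub>C op_apply A x"
  using op_apply[of A] by (simp add: clinear_def)

lemmas op_apply_add = linear_add[OF bounded_linear.linear[OF bounded_linear_op_apply]]
lemmas op_apply_diff = linear_diff[OF bounded_linear.linear[OF bounded_linear_op_apply]]
lemmas op_apply_cmul = linear_scale[OF bounded_linear.linear[OF bounded_linear_op_apply]]

lemma op_apply_norm_bound: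
  obtains K where "0 < K" and "\<And>x. norm (op_apply A x) \<le> K * norm x"
proof -
  from bounded_linear.pos_bounded[OF bounded_linear_op_apply[of A]]
  obtain K where "0 < K" "\<And>x. norm (op_apply A x) \<le> norm x * K" by blast
  then show thesis by (intro that[of K]) (simp_all add: mult.commute)
qed

lemma bounded_opI:
  assumes "\<And>x y. f (x + y) = f x + f y" and "\<And>c x. f (c *\<^sub>C x) = c *\<^sub>C f x"
    and "\<And>x. norm (f x) \<le> K * norm x"
  obtains S where "op_apply S = f"
proof -
  have "bounded_linear f"
    by (rule bounded_linear_intro[where K = K])
       (use assms in \<open>simp_all add: mult.commute flip: scaleC_of_real\<close>)
  then have "op_apply (Bounded_op f) = f"
    by (intro Bounded_op_inverse) (simp add: clinear_def assms)
  then show thesis by (rule that)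
qed

section \<open>Existence of adjoints and self-adjoint operators\<close>

lemma op_adj_eqI:
  assumes "\<And>x y. cinner (op_apply A x) y = cinner x (op_apply S y)"
  shows "op_adj A = S"
  unfolding op_adj_def
proof (rule the_equality)
  fix T assume "\<forall>x y. cinner (op_apply A x) y = cinner x (op_apply T y)"
  with assms have "cinner x (op_apply T y) = cinner x (op_apply S y)" for x y by metis
  then show "T = S" by (intro bounded_op_eqI cinner_eqI)
qed (use assms in simp)

text \<open>This shows that the description in \<open>op_adj\<close> denotes. Riesz applied to
  \<open>\<lambda>x. cinner (op_apply A x) y\<close> gives a vector \<open>s y\<close>; its
  uniqueness makes \<open>s\<close> linear, and testing the identity at x = \<open>s y\<close>
  bounds \<open>s\<close> by the bound of \<open>A\<close>.\<close>

lemma cinner_op_adj: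
  fixes A :: "'a::complex_hilbert bounded_op"
  shows "cinner (op_apply A x) y = cinner x (op_apply (op_adj A) y)"
proof -
  have "\<exists>z. \<forall>x. cinner (op_apply A x) y = cinner x z" for y
  proof -
    have "bounded_linear (\<lambda>x. cinner (op_apply A x) y)"
      by (rule bounded_linear_compose[OF bounded_linear_cinner_left bounded_linear_op_apply])
    then show ?thesis
      by (rule riesz_representation) (auto simp: op_apply_scaleC cinner_scaleC_left)
  qed
  then obtain s where s: "\<And>x y. cinner (op_apply A x) y = cinner x (s y)" by metis
  obtain K where K: "0 < K" "\<And>x. norm (op_apply A x) \<le> K * norm x"
    using op_apply_norm_bound by blast
  have "norm (s y) \<le> K * norm y" for y
  proof -
    have "(norm (s y))\<^sup>2 = Re (cinner (op_apply A (s y)) y)"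
      by (simp add: s Re_cinner_self)
    also have "\<dots> \<le> norm (op_apply A (s y)) * norm y"
      using Re_cinner_le_norm[of "op_apply A (s y)" y] by simp
    also have "\<dots> \<le> norm (s y) * (K * norm y)"
      using mult_right_mono[OF K(2)[of "s y"], of "norm y"] by (simp add: mult_ac)
    finally show ?thesis
      using K(1) by (cases "norm (s y) = 0") (auto simp: power2_eq_square)
  qed
  moreover have "s (x + y) = s x + s y" for x y
    by (rule cinner_eqI) (simp add: cinner_add_right flip: s)
  moreover have "s (c *\<^sub>C x) = c *\<^sub>C s x" for c x
    by (rule cinner_eqI) (simp add: cinner_scaleC_right flip: s)
  ultimately obtain S where "op_apply S = s" using bounded_opI[of s K] by metis
  then have "op_adj A = S" by (intro op_adj_eqI) (simp add: s)
  then show ?thesis using s \<open>op_apply S = s\<close> by simp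
qed

lemma selfadjoint_iff:
  "selfadjoint (A :: 'a::complex_hilbert bounded_op)
    \<longleftrightarrow> (\<forall>x y. cinner (op_apply A x) y = cinner x (op_apply A y))"
  unfolding selfadjoint_def by (metis cinner_op_adj op_adj_eqI)

lemma selfadjointD:
  "selfadjoint (A :: 'a::complex_hilbert bounded_op) \<Longrightarrow> cinner (op_apply A x) y = cinner x (op_apply A y)"
  by (simp add: selfadjoint_iff)

lemma selfadjoint_op_adj_times: "selfadjoint (op_adj A * (A :: 'a::complex_hilbert bounded_op))"
  unfolding selfadjoint_iff
  by (metis cinner_commute cinner_op_adj op_apply_times)

lemma selfadjoint_one: "selfadjoint (1 :: 'a::complex_hilbert bounded_op)"
  and selfadjoint_zero: "selfadjoint (0 :: 'a::complex_hilbert bounded_op)"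
  by (simp_all add: selfadjoint_iff)

lemma
  fixes A B :: "'a::complex_hilbert bounded_op"
  assumes "selfadjoint A" and "selfadjoint B"
  shows selfadjoint_add: "selfadjoint (A + B)"
    and selfadjoint_diff: "selfadjoint (A - B)"
    and selfadjoint_sandwich: "selfadjoint (A * B * A)"
  using assms
  by (simp_all add: selfadjoint_iff cinner_add_left cinner_add_right cinner_diff_left cinner_diff_right)

lemma selfadjoint_scaleR:
  "selfadjoint (A :: 'a::complex_hilbert bounded_op) \<Longrightarrow> selfadjoint (r *\<^sub>R A)"
  by (simp add: selfadjoint_iff cinner_scaleR_left cinner_scaleR_right)

lemma selfadjoint_power2:
  "selfadjoint (A :: 'a::complex_hilbert bounded_op) \<Longrightarrow> selfadjoint (A\<^sup>2)"
  by (simp add: selfadjoint_iff power2_eq_square)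

lemmas selfadjoint_intros = selfadjoint_one selfadjoint_zero selfadjoint_add selfadjoint_diff
  selfadjoint_sandwich selfadjoint_scaleR selfadjoint_power2 selfadjoint_op_adj_times

section \<open>The order on operators\<close>

abbreviation qform :: "'a::complex_inner bounded_op \<Rightarrow> 'a \<Rightarrow> real" where
  "qform A x \<equiv> Re (cinner (op_apply A x) x)"

lemma qform_add: "qform (A + B) x = qform A x + qform B x"
  and qform_diff: "qform (A - B) x = qform A x - qform B x"
  and qform_scaleR: "qform (r *\<^sub>R A) x = r * qform A x"
  and qform_one: "qform 1 x = (norm x)\<^sup>2"
  by (simp_all add: cinner_add_left cinner_diff_left cinner_scaleR_left Re_cinner_self)

lemmas qform_simps = qform_add qform_diff qform_scaleR qform_one

lemma qform_sandwich:
  "selfadjoint (A :: 'a::complex_hilbert bounded_op) \<Longrightarrow> qform (A * B * A) x = qform B (op_apply A x)"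
  by (simp add: selfadjointD)

lemma qform_square:
  "selfadjoint (A :: 'a::complex_hilbert bounded_op) \<Longrightarrow> qform (A * A) x = (norm (op_apply A x))\<^sup>2"
  by (simp add: selfadjointD[of A "op_apply A x"] Re_cinner_self)

lemma qform_op_adj_times:
  "qform (op_adj A * A) x = (norm (op_apply (A :: 'a::complex_hilbert bounded_op) x))\<^sup>2"
  by (metis Re_cinner_self cinner_op_adj Re_cinner_commute op_apply_times)

lemma op_leI:
  "\<lbrakk>selfadjoint A; selfadjoint B; \<And>x. qform A x \<le> qform B x\<rbrakk> \<Longrightarrow> A \<preceq> B"
  by (simp add: op_le_def)

lemma op_leD: "A \<preceq> B \<Longrightarrow> qform A x \<le> qform B x"
  by (simp add: op_le_def)

lemma scaleR_one_op_leD: "r *\<^sub>R 1 \<preceq> A \<Longrightarrow> r * (norm x)\<^sup>2 \<le> qform A x"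
  using op_leD[of "r *\<^sub>R 1" A x] unfolding qform_simps by simp

lemma op_le_scaleR_oneD: "A \<preceq> r *\<^sub>R 1 \<Longrightarrow> qform A x \<le> r * (norm x)\<^sup>2"
  using op_leD[of A "r *\<^sub>R 1" x] unfolding qform_simps by simp

lemma positive_op_iff:
  "positive_op (A :: 'a::complex_hilbert bounded_op) \<longleftrightarrow> selfadjoint A \<and> (\<forall>x. 0 \<le> qform A x)"
  by (simp add: positive_op_def op_le_def selfadjoint_zero)

lemma positive_op_selfadjoint: "positive_op A \<Longrightarrow> selfadjoint A"
  by (simp add: positive_op_def op_le_def)

lemma op_le_iff_diff:
  fixes A B :: "'a::complex_hilbert bounded_op"
  assumes "selfadjoint A" and "selfadjoint B"
  shows "A \<preceq> B \<longleftrightarrow> positive_op (B - A)"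
  using assms by (simp add: positive_op_iff op_le_def selfadjoint_diff qform_diff del: op_apply_minus)

text \<open>Cauchy--Schwarz for the form of \<open>U\<close> and the vectors \<open>x\<close>, \<open>U x\<close>.\<close>

lemma norm_power2_le_qform:
  fixes U :: "'a::complex_hilbert bounded_op"
  assumes U: "positive_op U" and r: "U \<preceq> r *\<^sub>R 1"
  shows "(norm (op_apply U x))\<^sup>2 \<le> r * qform U x"
proof -
  let ?y = "op_apply U x"
  have sa: "selfadjoint U" using U by (rule positive_op_selfadjoint)
  have pos: "0 \<le> qform U x" for x using U by (simp add: positive_op_iff)
  have "(Re (cinner ?y ?y))\<^sup>2 \<le> qform U x * qform U ?y"
  proof (rule discriminant_nonpos)
    fix t
    have "Re (cinner (op_apply U ?y) x) = Re (cinner ?y ?y)"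
      using selfadjointD[OF sa, of ?y x] by simp
    then have "qform U (x + t *\<^sub>R ?y) = qform U x + 2 * t * Re (cinner ?y ?y) + t\<^sup>2 * qform U ?y"
      by (simp add: op_apply_add op_apply_cmul cinner_add_left cinner_add_right cinner_scaleR_left
          cinner_scaleR_right power2_eq_square algebra_simps)
    with pos show "0 \<le> qform U x + 2 * t * Re (cinner ?y ?y) + t\<^sup>2 * qform U ?y" by metis
  qed (rule pos)
  also have "\<dots> \<le> qform U x * (r * (norm ?y)\<^sup>2)"
    by (rule mult_left_mono[OF op_le_scaleR_oneD[OF r] pos])
  finally have le: "(norm ?y)\<^sup>2 * (norm ?y)\<^sup>2 \<le> (r * qform U x) * (norm ?y)\<^sup>2"
    by (simp add: Re_cinner_self power2_eq_square mult_ac)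
  show ?thesis
    by (cases "?y = 0") (use mult_right_le_imp_le[OF le] in simp_all)
qed

lemma norm_le_of_op_le:
  fixes U :: "'a::complex_hilbert bounded_op"
  assumes "positive_op U" and "U \<preceq> r *\<^sub>R 1" and "0 \<le> r"
  shows "norm (op_apply U x) \<le> r * norm x"
proof (rule power2_le_imp_le)
  have "(norm (op_apply U x))\<^sup>2 \<le> r * (r * (norm x)\<^sup>2)"
    using norm_power2_le_qform[OF assms(1,2)] mult_left_mono[OF op_le_scaleR_oneD[OF assms(2)] assms(3)]
    by (rule order_trans)
  then show "(norm (op_apply U x))\<^sup>2 \<le> (r * norm x)\<^sup>2"
    by (simp add: power_mult_distrib power2_eq_square mult_ac)
qed (use assms(3) in simp)

text \<open>By Cauchy-Schwarz a lower bound on the form is a lower bound on the norm; in particular,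
  for r > 0, \<open>U\<close> is injective.\<close>

lemma norm_ge_of_op_ge:
  fixes U :: "'a::complex_hilbert bounded_op"
  assumes "r *\<^sub>R 1 \<preceq> U"
  shows "r * norm x \<le> norm (op_apply U x)"
proof (cases "x = 0")
  case False
  have "r * (norm x)\<^sup>2 \<le> norm (op_apply U x) * norm x"
    using scaleR_one_op_leD[OF assms, of x] Re_cinner_le_norm[of "op_apply U x" x] by linarith
  then show ?thesis using False by (simp add: power2_eq_square flip: mult.assoc)
qed simp

lemma positive_op_of_ge:
  fixes U :: "'a::complex_hilbert bounded_op"
  assumes "r *\<^sub>R 1 \<preceq> U" and "0 \<le> r"
  shows "positive_op U"
proof -
  have "0 \<le> qform U x" for x
    using scaleR_one_op_leD[OF assms(1), of x] assms(2) by (meson order_trans mult_nonneg_nonneg zero_le_power2)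
  then show ?thesis using assms(1) by (simp add: positive_op_iff op_le_def)
qed

text \<open>The clause c <= N serves the callers: it keeps constants such as 1 - c/N
  nonnegative.\<close>

lemma op_le_scaleR_one_exists:
  fixes U :: "'a::complex_hilbert bounded_op"
  assumes "selfadjoint U"
  obtains N where "c \<le> N" and "0 < N" and "U \<preceq> N *\<^sub>R 1"
proof -
  obtain K where K: "0 < K" "\<And>x. norm (op_apply U x) \<le> K * norm x" using op_apply_norm_bound by blast
  have "qform U x \<le> max c K * (norm x)\<^sup>2" for x
  proof -
    have "qform U x \<le> norm (op_apply U x) * norm x" using Re_cinner_le_norm[of "op_apply U x" x] by simp
    also have "\<dots> \<le> (max c K * norm x) * norm x"
      by (intro mult_right_mono order_trans[OF K(2)]) auto
    finally show ?thesis by (simp add: power2_eq_square mult_ac)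
  qed
  then have "U \<preceq> max c K *\<^sub>R 1"
    unfolding qform_simps[symmetric] by (intro op_leI selfadjoint_intros assms)
  then show thesis using K(1) by (intro that[of "max c K"]) auto
qed

lemma op_le_scaleR_oneI:
  fixes A :: "'a::complex_hilbert bounded_op"
  assumes "selfadjoint A"
  shows "(\<And>x. qform A x \<le> r * (norm x)\<^sup>2) \<Longrightarrow> A \<preceq> r *\<^sub>R 1"
    and "(\<And>x. r * (norm x)\<^sup>2 \<le> qform A x) \<Longrightarrow> r *\<^sub>R 1 \<preceq> A"
  unfolding qform_one[symmetric] qform_scaleR[symmetric] by (intro op_leI selfadjoint_intros assms; simp)+

text \<open>This is (X - a) (b - X) >= 0 in terms of forms. No functional calculus is involved:
  \<open>norm_power2_le_qform\<close> is applied to X - a, which lies between 0 and b - a.\<close>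

lemma qform_interval:
  fixes X :: "'a::complex_hilbert bounded_op"
  assumes "a *\<^sub>R 1 \<preceq> X" and "X \<preceq> b *\<^sub>R 1"
  shows "(norm (op_apply X x))\<^sup>2 + a * b * (norm x)\<^sup>2 \<le> (a + b) * qform X x"
proof -
  have sa: "selfadjoint X" using assms by (simp add: op_le_def)
  have "positive_op (X - a *\<^sub>R 1)"
    using assms(1) by (simp add: sa selfadjoint_intros flip: op_le_iff_diff)
  moreover have "X - a *\<^sub>R 1 \<preceq> (b - a) *\<^sub>R 1"
    by (intro op_le_scaleR_oneI selfadjoint_intros sa)
       (use op_le_scaleR_oneD[OF assms(2)] in \<open>simp only: qform_simps left_diff_distrib diff_right_mono\<close>)
  ultimately have "(norm (op_apply (X - a *\<^sub>R 1) x))\<^sup>2 \<le> (b - a) * qform (X - a *\<^sub>R 1) x"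
    by (rule norm_power2_le_qform)
  moreover have "(norm (op_apply (X - a *\<^sub>R 1) x))\<^sup>2
      = (norm (op_apply X x))\<^sup>2 - 2 * a * qform X x + a\<^sup>2 * (norm x)\<^sup>2"
    by (simp add: norm_diff_power2 cinner_scaleR_right power_mult_distrib)
  ultimately show ?thesis
    unfolding qform_simps by (simp add: algebra_simps power2_eq_square)
qed

section \<open>Inverses\<close>

lemma
  assumes "invertible_op A"
  shows op_inv_right: "A * op_inv A = 1" and op_inv_left: "op_inv A * A = 1"
proof -
  obtain S where S: "A * S = 1" "S * A = 1" using assms by (auto simp: invertible_op_def)
  have "op_inv A = S"
    unfolding op_inv_def using S by (intro the_equality) (auto, metis mult.assoc mult_1 mult_1_right)
  then show "A * op_inv A = 1" "op_inv A * A = 1" using S by simp_all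
qed

lemma
  assumes "invertible_op A"
  shows op_apply_op_inv: "op_apply A (op_apply (op_inv A) x) = x"
    and op_inv_op_apply: "op_apply (op_inv A) (op_apply A x) = x"
  using op_inv_right[OF assms] op_inv_left[OF assms]
  by (metis op_apply_one op_apply_times)+

lemma selfadjoint_op_inv:
  fixes A :: "'a::complex_hilbert bounded_op"
  assumes "invertible_op A" and "selfadjoint A"
  shows "selfadjoint (op_inv A)"
  unfolding selfadjoint_iff
  by (metis assms op_apply_op_inv selfadjointD)

text \<open>\<open>T x = y\<close> is solved by iterating \<open>x \<mapsto> x - (T x - y) / N\<close>, a contraction when \<open>c \<le> T \<le> N\<close>.\<close>

lemma invertible_op_of_ge:
  fixes T :: "'a::complex_hilbert bounded_op"
  assumes c: "0 < c" and T: "c *\<^sub>R 1 \<preceq> T"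
  shows "invertible_op T"
proof -
  have sa: "selfadjoint T" using T by (simp add: op_le_def)
  obtain N where N: "c \<le> N" "0 < N" "T \<preceq> N *\<^sub>R 1" by (rule op_le_scaleR_one_exists[OF sa])
  define D where "D = 1 - (1 / N) *\<^sub>R T"
  have saD: "selfadjoint D" unfolding D_def by (intro selfadjoint_intros sa)
  have "0 \<le> qform D x" for x
    using op_le_scaleR_oneD[OF N(3), of x] N(2) unfolding D_def qform_simps by (simp add: field_simps)
  then have "positive_op D" using saD by (simp add: positive_op_iff)
  moreover have "D \<preceq> (1 - c / N) *\<^sub>R 1"
  proof (rule op_le_scaleR_oneI[OF saD])
    fix x show "qform D x \<le> (1 - c / N) * (norm x)\<^sup>2"
      using scaleR_one_op_leD[OF T, of x] N(2) unfolding D_def qform_simps by (simp add: field_simps)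
  qed
  ultimately have D: "norm (op_apply D x) \<le> (1 - c / N) * norm x" for x
    by (rule norm_le_of_op_le) (use N in simp)
  have "\<exists>x. op_apply T x = y" for y
  proof -
    have "\<exists>!x. op_apply D x + (1 / N) *\<^sub>R y = x"
      by (rule banach_fix_type[where c = "1 - c / N"])
         (use N c D in \<open>auto simp: dist_norm simp flip: op_apply_diff\<close>)
    then obtain x where "op_apply D x + (1 / N) *\<^sub>R y = x" by blast
    then have "(1 / N) *\<^sub>R op_apply T x = (1 / N) *\<^sub>R y"
      by (auto simp: D_def algebra_simps)
    then show ?thesis using N(2) by (intro exI[of _ x]) auto
  qed
  then obtain s where s: "\<And>y. op_apply T (s y) = y" by metis
  have inj: "x = y" if "op_apply T x = op_apply T y" for x y
  proof -
    have "c * norm (x - y) \<le> 0"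
      using norm_ge_of_op_ge[OF T, of "x - y"] that by (simp add: op_apply_diff)
    then show ?thesis using c by (simp add: mult_le_0_iff)
  qed
  \<comment> \<open>Injectivity of T passes additivity and homogeneity to the solution map
    \<open>s\<close>, and the lower bound on T bounds it.\<close>
  have "norm (s y) \<le> (1 / c) * norm y" for y
    using norm_ge_of_op_ge[OF T, of "s y"] c by (simp add: s field_simps)
  moreover have "s (x + y) = s x + s y" for x y
    by (rule inj) (simp add: s op_apply_add)
  moreover have "s (a *\<^sub>C x) = a *\<^sub>C s x" for a x
    by (rule inj) (simp add: s op_apply_scaleC)
  ultimately obtain S where S: "op_apply S = s" using bounded_opI[of s "1 / c"] by metis
  have "T * S = 1" by (rule bounded_op_eqI) (simp add: S s)
  moreover have "S * T = 1" by (rule bounded_op_eqI) (simp add: S s inj)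
  ultimately show ?thesis by (auto simp: invertible_op_def)
qed

lemma norm_ge_of_invertible:
  assumes "invertible_op T"
  obtains c where "0 < c" and "\<And>x. c * norm x \<le> norm (op_apply T x)"
proof -
  obtain K where K: "0 < K" "\<And>x. norm (op_apply (op_inv T) x) \<le> K * norm x"
    by (rule op_apply_norm_bound) blast
  have "1 / K * norm x \<le> norm (op_apply T x)" for x
    using K(2)[of "op_apply T x"] K(1) by (simp add: op_inv_op_apply[OF assms] field_simps)
  with K(1) show thesis by (intro that[of "1 / K"]) auto
qed

text \<open>The inverse only gives d ||x|| <= ||T x||; positivity turns this into a bound on the
  form, since d^2 ||x||^2 <= ||T x||^2 <= N <T x, x>.\<close>

lemma positive_invertible_ge:
  fixes T :: "'a::complex_hilbert bounded_op"
  assumes T: "positive_op T" and "invertible_op T"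
  obtains c where "0 < c" and "c *\<^sub>R 1 \<preceq> T"
proof -
  obtain d where d: "0 < d" "\<And>x. d * norm x \<le> norm (op_apply T x)"
    using norm_ge_of_invertible[OF assms(2)] by blast
  have sa: "selfadjoint T" using T by (rule positive_op_selfadjoint)
  obtain N where N: "0 < N" "T \<preceq> N *\<^sub>R 1" using op_le_scaleR_one_exists[OF sa] by blast
  have "(d\<^sup>2 / N) * (norm x)\<^sup>2 \<le> qform T x" for x
  proof -
    have "(d * norm x)\<^sup>2 \<le> (norm (op_apply T x))\<^sup>2"
      using d by (intro power_mono) auto
    also have "\<dots> \<le> N * qform T x" by (rule norm_power2_le_qform[OF T N(2)])
    finally show ?thesis using N(1) by (simp add: field_simps power_mult_distrib)
  qed
  then have "(d\<^sup>2 / N) *\<^sub>R 1 \<preceq> T" by (rule op_le_scaleR_oneI[OF sa])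
  with d(1) N(1) show thesis by (intro that[of "d\<^sup>2 / N"]) auto
qed

section \<open>Square roots\<close>

text \<open>For \<open>W = b\<^sup>2 (1 - B)\<close> a fixed point \<open>Y\<close> of \<open>Y \<mapsto> (B + Y\<^sup>2) / 2\<close> gives the square root
  \<open>b (1 - Y)\<close>; the bound \<open>a\<^sup>2 \<le> W\<close> makes this map a contraction on the ball of radius \<open>1 - a / b\<close>.\<close>

lemma sqrt_exists:
  fixes W :: "'a::complex_hilbert bounded_op"
  assumes a: "0 < a" and ab: "a \<le> b" and Wa: "a\<^sup>2 *\<^sub>R 1 \<preceq> W" and Wb: "W \<preceq> b\<^sup>2 *\<^sub>R 1"
  obtains S where "S * S = W" and "a *\<^sub>R 1 \<preceq> S" and "\<And>C. C * W = W * C \<Longrightarrow> C * S = S * C"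
proof -
  have b: "0 < b" using a ab by simp
  define r where "r = 1 - a / b"
  have r: "0 \<le> r" "r < 1" using a ab b by (auto simp: r_def)
  have sa: "selfadjoint W" using Wa by (simp add: op_le_def)
  define B where "B = 1 - (1 / b\<^sup>2) *\<^sub>R W"
  have saB: "selfadjoint B" unfolding B_def by (intro selfadjoint_intros sa)
  \<comment> \<open>This choice of r lets \<open>f\<close> map the ball of radius r into itself:
    half of (1 - a^2/b^2) + r^2 is exactly r.\<close>
  have rr: "1 - a\<^sup>2 / b\<^sup>2 + r * r = 2 * r"
    using b by (simp add: r_def power2_eq_square field_simps)
  have "0 \<le> qform B x" for x
    using op_le_scaleR_oneD[OF Wb, of x] b unfolding B_def qform_simps by (simp add: field_simps)
  then have "positive_op B" using saB by (simp add: positive_op_iff)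
  moreover have "B \<preceq> (1 - a\<^sup>2 / b\<^sup>2) *\<^sub>R 1"
  proof (rule op_le_scaleR_oneI[OF saB])
    fix x show "qform B x \<le> (1 - a\<^sup>2 / b\<^sup>2) * (norm x)\<^sup>2"
      using scaleR_one_op_leD[OF Wa, of x] b unfolding B_def qform_simps by (simp add: field_simps)
  qed
  moreover have le1: "0 \<le> 1 - a\<^sup>2 / b\<^sup>2"
    using a ab b power_mono[of a b 2] by (simp add: field_simps)
  ultimately have normB: "norm (op_apply B x) \<le> (1 - a\<^sup>2 / b\<^sup>2) * norm x" for x
    by (rule norm_le_of_op_le)
  define \<beta> where "\<beta> = Blinfun (op_apply B)"
  have \<beta>: "blinfun_apply \<beta> = op_apply B"
    unfolding \<beta>_def by (rule bounded_linear_Blinfun_apply[OF bounded_linear_op_apply])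
  have norm\<beta>: "norm \<beta> \<le> 1 - a\<^sup>2 / b\<^sup>2"
    by (rule norm_blinfun_bound[OF le1]) (use normB in \<open>simp add: \<beta>\<close>)
  have commB: "C * B = B * C" if "C * W = W * C" for C
  proof (rule bounded_op_eqI)
    fix x
    have "op_apply C (op_apply W x) = op_apply W (op_apply C x)"
      using that by (metis op_apply_times)
    then show "op_apply (C * B) x = op_apply (B * C) x"
      by (simp add: B_def op_apply_diff op_apply_cmul)
  qed
  define f where "f Y = (1 / 2) *\<^sub>R (\<beta> + (Y o\<^sub>L Y))" for Y :: "'a \<Rightarrow>\<^sub>L 'a"
  have f: "blinfun_apply (f Y) x = (1 / 2) *\<^sub>R (op_apply B x + Y (Y x))" for Y x
    by (simp add: f_def \<beta> blinfun.scaleR_left blinfun.add_left)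
  \<comment> \<open>Besides the norm bound, all that is wanted of the fixed point is recorded as
    closed conditions preserved by \<open>f\<close>: complex homogeneity, symmetry, and commuting
    with every operator that commutes with \<open>W\<close>. The last one, a disjunction so that
    closedness is immediate, yields uniqueness of the root later.\<close>
  define K where "K = {Y :: 'a \<Rightarrow>\<^sub>L 'a. norm Y \<le> r
      \<and> (\<forall>c x. blinfun_apply Y (c *\<^sub>C x) = c *\<^sub>C blinfun_apply Y x)
      \<and> (\<forall>x y. cinner (blinfun_apply Y x) y = cinner x (blinfun_apply Y y))
      \<and> (\<forall>C x. C * W \<noteq> W * C \<or> op_apply C (blinfun_apply Y x) = blinfun_apply Y (op_apply C x))}"
  have cont: "continuous_on UNIV (\<lambda>Y :: 'a \<Rightarrow>\<^sub>L 'a. g (Y x))" if "bounded_linear g"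
    for g :: "'a \<Rightarrow> 'b::real_normed_vector" and x
    by (rule bounded_linear.continuous_on[OF that])
       (rule linear_continuous_on[OF blinfun.bounded_linear_left])
  have "closed K"
    unfolding K_def
    by (intro closed_Collect_conj closed_Collect_all closed_Collect_disj closed_Collect_const
        closed_Collect_le closed_Collect_eq continuous_on_norm continuous_on_id continuous_on_const
        cont[OF bounded_linear_ident] cont[OF bounded_linear_scaleC] cont[OF bounded_linear_op_apply]
        cont[OF bounded_linear_cinner_left] cont[OF bounded_linear_cinner_right])
  then have "complete K" by (simp add: complete_eq_closed)
  moreover have "K \<noteq> {}"
  proof -
    have "0 \<in> K" using r by (simp add: K_def linear_0[OF bounded_linear.linear[OF bounded_linear_op_apply]])
    then show ?thesis by blast
  qed
  moreover have "f ` K \<subseteq> K"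
  proof
    fix Z assume "Z \<in> f ` K"
    then obtain Y where Y: "Y \<in> K" and Z: "Z = f Y" by blast
    have "norm (Y o\<^sub>L Y) \<le> r * r"
      using Y r by (intro order_trans[OF norm_blinfun_compose] mult_mono) (auto simp: K_def)
    then have "norm (\<beta> + (Y o\<^sub>L Y)) \<le> 2 * r"
      using norm\<beta> norm_triangle_ineq[of \<beta> "Y o\<^sub>L Y"] rr by linarith
    then have "norm (f Y) \<le> r" by (simp add: f_def)
    moreover have "f Y (c *\<^sub>C x) = c *\<^sub>C f Y x" for c x
      using Y by (simp add: K_def f op_apply_scaleC scaleC_add_right scaleC_scaleR)
    moreover have "cinner (f Y x) y = cinner x (f Y y)" for x y
      using Y selfadjointD[OF saB]
      by (simp add: K_def f cinner_scaleR_left cinner_scaleR_right cinner_add_left cinner_add_right)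
    moreover have "op_apply C (f Y x) = f Y (op_apply C x)" if "C * W = W * C" for C x
    proof -
      have "op_apply C (op_apply B x) = op_apply B (op_apply C x)"
        using commB[OF that] by (metis op_apply_times)
      then show ?thesis using Y that by (simp add: K_def f op_apply_cmul op_apply_add)
    qed
    ultimately show "Z \<in> K" by (auto simp: K_def Z)
  qed
  moreover have "dist (f Y) (f Z) \<le> r * dist Y Z" if YZ: "Y \<in> K" "Z \<in> K" for Y Z
  proof -
    \<comment> \<open>Y^2 - Z^2 = Y (Y - Z) + (Y - Z) Z holds without commutativity; each summand
      costs a factor r, and the 1/2 in \<open>f\<close> compensates for there being two.\<close>
    have "f Y - f Z = (1 / 2) *\<^sub>R ((Y o\<^sub>L (Y - Z)) + ((Y - Z) o\<^sub>L Z))"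
      by (rule blinfun_eqI)
         (simp add: f blinfun.scaleR_left blinfun.add_left blinfun.diff_left blinfun.diff_right
           flip: scaleR_diff_right)
    moreover have "norm (Y o\<^sub>L (Y - Z)) \<le> r * norm (Y - Z)" "norm ((Y - Z) o\<^sub>L Z) \<le> norm (Y - Z) * r"
      using YZ r by (auto intro!: order_trans[OF norm_blinfun_compose] mult_mono simp: K_def)
    ultimately show ?thesis
      using norm_triangle_ineq[of "Y o\<^sub>L (Y - Z)" "(Y - Z) o\<^sub>L Z"]
      by (simp add: dist_norm mult.commute)
  qed
  ultimately have "\<exists>!Y\<in>K. f Y = Y" using r by (intro Banach_fix[where c = r])
  then obtain Y where Y: "Y \<in> K" "f Y = Y" by blast
  obtain V where V: "op_apply V = blinfun_apply Y"
    by (rule bounded_opI[of "blinfun_apply Y" "norm Y"])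
       (use Y(1) in \<open>auto simp: K_def blinfun.add_right norm_blinfun\<close>)
  have saV: "selfadjoint V" using Y(1) by (simp add: selfadjoint_iff V K_def)
  define S where "S = b *\<^sub>R (1 - V)"
  \<comment> \<open>The fixed point equation read as V^2 = 2 V - B, so that (1 - V)^2 = 1 - B = W /
    b^2.\<close>
  have VV: "op_apply V (op_apply V x) = 2 *\<^sub>R op_apply V x - op_apply B x" for x
  proof -
    have "op_apply V x = (1 / 2) *\<^sub>R (op_apply B x + op_apply V (op_apply V x))"
      using f[of Y x] Y(2) by (simp add: V)
    then have "2 *\<^sub>R op_apply V x = 2 *\<^sub>R (1 / 2) *\<^sub>R (op_apply B x + op_apply V (op_apply V x))"
      by (rule arg_cong)
    then show ?thesis by simp
  qed
  show thesis
  proof (rule that[of S])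
    show "S * S = W"
    proof (rule bounded_op_eqI)
      fix x
      have "op_apply (S * S) x = (b * b) *\<^sub>R (x - op_apply B x)"
        by (simp add: S_def op_apply_cmul op_apply_diff VV scaleR_2 algebra_simps)
      also have "\<dots> = op_apply W x" using b by (simp add: B_def power2_eq_square)
      finally show "op_apply (S * S) x = op_apply W x" .
    qed
    show "a *\<^sub>R 1 \<preceq> S"
    proof (rule op_le_scaleR_oneI)
      show "selfadjoint S" unfolding S_def by (intro selfadjoint_intros saV)
      fix x
      have "qform V x \<le> norm (op_apply V x) * norm x" using Re_cinner_le_norm[of "op_apply V x" x] by simp
      also have "\<dots> \<le> (r * norm x) * norm x"
        using Y(1) unfolding V K_def
        by (intro mult_right_mono order_trans[OF norm_blinfun]) auto
      finally have "qform V x \<le> r * (norm x)\<^sup>2" by (simp add: power2_eq_square)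
      then have "b * ((norm x)\<^sup>2 - r * (norm x)\<^sup>2) \<le> qform S x"
        unfolding S_def qform_simps using b by simp
      \<comment> \<open>The radius was chosen with b (1 - r) = a, which yields the lower bound on
        the root.\<close>
      moreover have "b * ((norm x)\<^sup>2 - r * (norm x)\<^sup>2) = a * (norm x)\<^sup>2"
        using b by (simp add: r_def field_simps)
      ultimately show "a * (norm x)\<^sup>2 \<le> qform S x" by simp
    qed
    fix C assume "C * W = W * C"
    then have "op_apply C (op_apply V x) = op_apply V (op_apply C x)" for x
      using Y(1) by (simp add: K_def V)
    then show "C * S = S * C"
      by (intro bounded_op_eqI) (simp add: S_def op_apply_diff op_apply_cmul)
  qed
qed

text \<open>The root S just constructed is the only positive one: T commutes with W = T^2, hence
  with S, so (S + T) (S - T) = 0, and S + T >= a is injective. Thus \<open>op_sqrt\<close> denotes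
  S.\<close>

lemma
  fixes W :: "'a::complex_hilbert bounded_op"
  assumes a: "0 < a" and Wa: "a\<^sup>2 *\<^sub>R 1 \<preceq> W"
  shows op_sqrt_square: "op_sqrt W * op_sqrt W = W"
    and op_sqrt_ge: "a *\<^sub>R 1 \<preceq> op_sqrt W"
    and op_sqrt_eqI: "positive_op T \<Longrightarrow> T * T = W \<Longrightarrow> op_sqrt W = T"
proof -
  have "selfadjoint W" using Wa by (simp add: op_le_def)
  then obtain N where N: "a\<^sup>2 \<le> N" "0 < N" "W \<preceq> N *\<^sub>R 1" using op_le_scaleR_one_exists by blast
  have "a \<le> sqrt N" "W \<preceq> (sqrt N)\<^sup>2 *\<^sub>R 1" using N by (auto intro: real_le_rsqrt)
  then obtain S where S: "S * S = W" "a *\<^sub>R 1 \<preceq> S" and comm: "\<And>C. C * W = W * C \<Longrightarrow> C * S = S * C"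
    using sqrt_exists[OF a _ Wa] by metis
  have unique: "T = S" if T: "positive_op T" "T * T = W" for T
  proof -
    have "T * W = W * T" using T(2) by (metis mult.assoc)
    then have "T * S = S * T" by (rule comm)
    then have 0: "(S + T) * (S - T) = 0" using S(1) T(2) by (simp add: algebra_simps)
    have sum: "a *\<^sub>R 1 \<preceq> S + T"
    proof (rule op_le_scaleR_oneI)
      show "selfadjoint (S + T)"
        using S(2) T(1) by (intro selfadjoint_intros) (auto simp: op_le_def positive_op_def)
      fix x show "a * (norm x)\<^sup>2 \<le> qform (S + T) x"
        using scaleR_one_op_leD[OF S(2), of x] T(1) unfolding qform_simps positive_op_iff by (simp add: add_increasing2)
    qed
    show ?thesis
    proof (rule bounded_op_eqI)
      fix x
      have "a * norm (op_apply (S - T) x) \<le> norm (op_apply ((S + T) * (S - T)) x)"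
        using norm_ge_of_op_ge[OF sum] by simp
      then have "a * norm (op_apply (S - T) x) \<le> 0" unfolding 0 by simp
      then show "op_apply T x = op_apply S x" using a by (simp add: mult_le_0_iff)
    qed
  qed
  have sqrt: "op_sqrt W = S"
    unfolding op_sqrt_def
  proof (rule the_equality)
    show "positive_op S \<and> S * S = W" using S(1) positive_op_of_ge[OF S(2)] a by simp
  qed (use unique in blast)
  show "op_sqrt W * op_sqrt W = W" unfolding sqrt by (rule S(1))
  show "a *\<^sub>R 1 \<preceq> op_sqrt W" unfolding sqrt by (rule S(2))
  show "op_sqrt W = T" if "positive_op T" "T * T = W"
    unfolding sqrt by (rule unique[OF that, symmetric])
qed

text \<open>The lower bound on \<open>X\<close> gives X* X >= c^2, the situation in which
  \<open>op_sqrt_square\<close> applies.\<close>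

lemma op_abs_power2:
  fixes X :: "'a::complex_hilbert bounded_op"
  assumes c: "0 < c" and X: "\<And>x. c * norm x \<le> norm (op_apply X x)"
  shows "(op_abs X)\<^sup>2 = op_adj X * X"
  unfolding op_abs_def power2_eq_square
proof (rule op_sqrt_square[OF c])
  show "c\<^sup>2 *\<^sub>R 1 \<preceq> op_adj X * X"
  proof (rule op_le_scaleR_oneI[OF selfadjoint_op_adj_times])
    fix x
    show "c\<^sup>2 * (norm x)\<^sup>2 \<le> qform (op_adj X * X) x"
      unfolding qform_op_adj_times power_mult_distrib[symmetric] using c X by (intro power_mono) auto
  qed
qed

section \<open>The geometric mean and positive maps\<close>

lemma positive_op_power2:
  fixes A :: "'a::complex_hilbert bounded_op"
  assumes "selfadjoint A"
  shows "positive_op (A\<^sup>2)"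
proof -
  have "0 \<le> qform (A\<^sup>2) x" for x unfolding power2_eq_square qform_square[OF assms] by simp
  then show ?thesis using assms by (simp add: positive_op_iff selfadjoint_power2)
qed

text \<open>Squaring does not respect the operator order in general; against scalars it does,
  because <A^2 x, x> = ||A x||^2.\<close>

lemma power2_ge:
  fixes A :: "'a::complex_hilbert bounded_op"
  assumes "m *\<^sub>R 1 \<preceq> A" and "0 \<le> m"
  shows "m\<^sup>2 *\<^sub>R 1 \<preceq> A\<^sup>2"
proof -
  have sa: "selfadjoint A" using assms by (simp add: op_le_def)
  have "m\<^sup>2 * (norm x)\<^sup>2 \<le> qform (A\<^sup>2) x" for x
    unfolding power2_eq_square[of A] qform_square[OF sa] power_mult_distrib[symmetric]
    using assms norm_ge_of_op_ge[OF assms(1)] by (intro power_mono) auto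
  then show ?thesis by (intro op_le_scaleR_oneI selfadjoint_intros sa)
qed

lemma power2_le:
  fixes A :: "'a::complex_hilbert bounded_op"
  assumes "positive_op A" and "A \<preceq> M *\<^sub>R 1" and "0 \<le> M"
  shows "A\<^sup>2 \<preceq> M\<^sup>2 *\<^sub>R 1"
proof -
  have sa: "selfadjoint A" using assms by (simp add: op_le_def)
  have "qform (A\<^sup>2) x \<le> M\<^sup>2 * (norm x)\<^sup>2" for x
    unfolding power2_eq_square[of A] qform_square[OF sa] power_mult_distrib[symmetric]
    using norm_le_of_op_le[OF assms] by (intro power_mono) auto
  then show ?thesis by (intro op_le_scaleR_oneI selfadjoint_intros sa)
qed

text \<open>All bounds on X are read off from ||X x|| = ||B A^-1 x||, a consequence of X^2 = A^-1
  B^2 A^-1. The lower bound on the mean ensures later that the squared modulus in the theorem can be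
  evaluated.\<close>

lemma
  fixes A B :: "'a::complex_hilbert bounded_op"
  assumes m: "0 < m1" "m1 \<le> M1" "0 < m2" "m2 \<le> M2"
    and A: "m1 *\<^sub>R 1 \<preceq> A" "A \<preceq> M1 *\<^sub>R 1" and B: "m2 *\<^sub>R 1 \<preceq> B" "B \<preceq> M2 *\<^sub>R 1"
  shows op_mean_power2_ge: "(m2 / M1 * m1\<^sup>2) *\<^sub>R 1 \<preceq> A\<^sup>2 \<sharp> B\<^sup>2"
    and diaz_metcalf: "(m1 * M1) *\<^sub>R B\<^sup>2 + (m2 * M2) *\<^sub>R A\<^sup>2 \<preceq> (m1 * m2 + M1 * M2) *\<^sub>R (A\<^sup>2 \<sharp> B\<^sup>2)"
proof -
  have sa: "selfadjoint A" "selfadjoint B" using A B by (simp_all add: op_le_def)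
  have pos: "positive_op A" "positive_op B" using A B m by (auto intro: positive_op_of_ge)
  have inv: "invertible_op A" by (rule invertible_op_of_ge[OF m(1) A(1)])
  have M: "0 < M1" "0 < M2" using m by simp_all
  have sqrtA: "op_sqrt (A\<^sup>2) = A"
    by (rule op_sqrt_eqI[OF m(1) power2_ge[OF A(1)] pos(1)]) (use m in \<open>simp_all add: power2_eq_square\<close>)
  define Ai where "Ai = op_inv A"
  have saAi: "selfadjoint Ai" unfolding Ai_def by (rule selfadjoint_op_inv[OF inv sa(1)])
  have AAi: "op_apply A (op_apply Ai x) = x" and AiA: "op_apply Ai (op_apply A x) = x" for x
    by (simp_all add: Ai_def op_apply_op_inv[OF inv] op_inv_op_apply[OF inv])
  define W where "W = Ai * B\<^sup>2 * Ai"
  have saW: "selfadjoint W" unfolding W_def by (intro selfadjoint_intros saAi sa)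
  have W: "qform W x = (norm (op_apply B (op_apply Ai x)))\<^sup>2" for x
    unfolding W_def qform_sandwich[OF saAi] power2_eq_square[of B] by (rule qform_square[OF sa(2)])
  define a where "a = m2 / M1"
  define b where "b = M2 / m1"
  have ab: "0 < a" "0 < b" using m M by (simp_all add: a_def b_def)
  \<comment> \<open>A <= M1 gives ||A^-1 x|| >= ||x|| / M1, whence a = m2 / M1; dually A >= m1 leads
    to b = M2 / m1.\<close>
  have lower: "a * norm x \<le> norm (op_apply B (op_apply Ai x))" for x
  proof -
    have "norm x \<le> M1 * norm (op_apply Ai x)"
      using norm_le_of_op_le[OF pos(1) A(2), of "op_apply Ai x"] M by (simp add: AAi)
    then have "a * norm x \<le> m2 * norm (op_apply Ai x)"
      using m M by (simp add: a_def field_simps)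
    also have "\<dots> \<le> norm (op_apply B (op_apply Ai x))" by (rule norm_ge_of_op_ge[OF B(1)])
    finally show ?thesis .
  qed
  have upper: "norm (op_apply B (op_apply Ai x)) \<le> b * norm x" for x
  proof -
    have "norm (op_apply B (op_apply Ai x)) \<le> M2 * norm (op_apply Ai x)"
      using norm_le_of_op_le[OF pos(2) B(2)] M by simp
    also have "\<dots> \<le> b * norm x"
      using norm_ge_of_op_ge[OF A(1), of "op_apply Ai x"] m M by (simp add: AAi b_def field_simps)
    finally show ?thesis .
  qed
  have Wa: "a\<^sup>2 *\<^sub>R 1 \<preceq> W"
    by (rule op_le_scaleR_oneI[OF saW], unfold W power_mult_distrib[symmetric])
       (use lower ab in \<open>intro power_mono, auto\<close>)
  define X where "X = op_sqrt W"
  have XX: "X * X = W" and Xa: "a *\<^sub>R 1 \<preceq> X"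
    unfolding X_def by (rule op_sqrt_square[OF ab(1) Wa] op_sqrt_ge[OF ab(1) Wa])+
  have saX: "selfadjoint X" using Xa by (simp add: op_le_def)
  have normX: "norm (op_apply X x) = norm (op_apply B (op_apply Ai x))" for x
    using W[of x] unfolding XX[symmetric] qform_square[OF saX] by simp
  have Xb: "X \<preceq> b *\<^sub>R 1"
  proof (rule op_le_scaleR_oneI[OF saX])
    fix x
    have "qform X x \<le> norm (op_apply X x) * norm x" using Re_cinner_le_norm[of "op_apply X x" x] by simp
    also have "\<dots> \<le> (b * norm x) * norm x" by (intro mult_right_mono) (simp_all add: normX upper)
    finally show "qform X x \<le> b * (norm x)\<^sup>2" by (simp add: power2_eq_square)
  qed
  have G: "A\<^sup>2 \<sharp> B\<^sup>2 = A * X * A"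
    by (simp add: op_mean_def sqrtA X_def W_def Ai_def)
  have qG: "qform (A\<^sup>2 \<sharp> B\<^sup>2) x = qform X (op_apply A x)" for x
    unfolding G by (rule qform_sandwich[OF sa(1)])
  have saG: "selfadjoint (A\<^sup>2 \<sharp> B\<^sup>2)" unfolding G by (intro selfadjoint_intros sa saX)
  show "(m2 / M1 * m1\<^sup>2) *\<^sub>R 1 \<preceq> A\<^sup>2 \<sharp> B\<^sup>2"
  proof (rule op_le_scaleR_oneI[OF saG])
    fix x
    have "(m1 * norm x)\<^sup>2 \<le> (norm (op_apply A x))\<^sup>2"
      using norm_ge_of_op_ge[OF A(1), of x] m by (intro power_mono) auto
    then have "a * (m1 * norm x)\<^sup>2 \<le> a * (norm (op_apply A x))\<^sup>2"
      using ab by simp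
    also have "\<dots> \<le> qform X (op_apply A x)" by (rule scaleR_one_op_leD[OF Xa])
    finally show "m2 / M1 * m1\<^sup>2 * (norm x)\<^sup>2 \<le> qform (A\<^sup>2 \<sharp> B\<^sup>2) x"
      by (simp add: qG a_def power_mult_distrib mult_ac)
  qed
  show "(m1 * M1) *\<^sub>R B\<^sup>2 + (m2 * M2) *\<^sub>R A\<^sup>2 \<preceq> (m1 * m2 + M1 * M2) *\<^sub>R (A\<^sup>2 \<sharp> B\<^sup>2)"
  proof (rule op_leI)
    fix x
    \<comment> \<open>At the vector A x the factor A^-1 cancels, so ||X A x|| = ||B x||. Multiplying
      by m1 M1 then clears the denominators of a and b.\<close>
    have "(norm (op_apply B x))\<^sup>2 + a * b * (norm (op_apply A x))\<^sup>2 \<le> (a + b) * qform (A\<^sup>2 \<sharp> B\<^sup>2) x"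
      using qform_interval[OF Xa Xb, of "op_apply A x"] by (simp only: normX AiA qG)
    then have "(m1 * M1) * ((norm (op_apply B x))\<^sup>2 + a * b * (norm (op_apply A x))\<^sup>2)
        \<le> (m1 * M1) * ((a + b) * qform (A\<^sup>2 \<sharp> B\<^sup>2) x)"
      using m M by simp
    moreover have "m1 * M1 * (a * b) = m2 * M2" "m1 * M1 * (a + b) = m1 * m2 + M1 * M2"
      using m M by (simp_all add: a_def b_def field_simps)
    ultimately have "m1 * M1 * (norm (op_apply B x))\<^sup>2 + m2 * M2 * (norm (op_apply A x))\<^sup>2
        \<le> (m1 * m2 + M1 * M2) * qform (A\<^sup>2 \<sharp> B\<^sup>2) x"
      by (simp only: distrib_left mult.assoc[symmetric])
    then show "qform ((m1 * M1) *\<^sub>R B\<^sup>2 + (m2 * M2) *\<^sub>R A\<^sup>2) x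
        \<le> qform ((m1 * m2 + M1 * M2) *\<^sub>R (A\<^sup>2 \<sharp> B\<^sup>2)) x"
      unfolding qform_simps power2_eq_square[of A] power2_eq_square[of B] qform_square[OF sa(1)]
        qform_square[OF sa(2)] .
  qed (intro selfadjoint_intros sa saG)+
qed

text \<open>With \<open>\<eta> = R \<xi>\<close>, \<open>R = Q\<^sup>1\<^sup>/\<^sup>2\<close>, the left-hand form at \<open>\<xi>\<close> is
  \<open>\<langle>P \<eta>, \<eta>\<rangle> - \<parallel>R\<^sup>-\<^sup>1 G \<eta>\<parallel>\<^sup>2\<close>, and
  \<open>s \<langle>G \<eta>, \<eta>\<rangle> = s \<langle>R\<^sup>-\<^sup>1 G \<eta>, R \<eta>\<rangle> \<le> \<parallel>R\<^sup>-\<^sup>1 G \<eta>\<parallel>\<^sup>2 + (s / 2)\<^sup>2 \<parallel>R \<eta>\<parallel>\<^sup>2\<close>.\<close>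

lemma sandwich_minus_op_abs_le:
  fixes P Q G :: "'a::complex_hilbert bounded_op"
  assumes Q: "0 < q" "q *\<^sub>R 1 \<preceq> Q" "Q \<preceq> n *\<^sub>R 1" "0 \<le> n"
    and G: "0 < g" "g *\<^sub>R 1 \<preceq> G" and P: "selfadjoint P"
    and le: "\<And>x. qform P x \<le> s * qform G x - t * qform Q x" and st: "t \<le> (s / 2)\<^sup>2"
  shows "op_sqrt Q * P * op_sqrt Q - (op_abs (op_inv (op_sqrt Q) * G * op_sqrt Q))\<^sup>2
    \<preceq> (((s / 2)\<^sup>2 - t) * n\<^sup>2) *\<^sub>R 1"
proof -
  define R where "R = op_sqrt Q"
  define Ri where "Ri = op_inv R"
  define Y where "Y = Ri * G * R"
  have sq: "0 < sqrt q" "(sqrt q)\<^sup>2 *\<^sub>R 1 \<preceq> Q" using Q by simp_all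
  have RR: "R * R = Q" and Rge: "sqrt q *\<^sub>R 1 \<preceq> R"
    unfolding R_def by (rule op_sqrt_square[OF sq] op_sqrt_ge[OF sq])+
  have invR: "invertible_op R" by (rule invertible_op_of_ge[OF sq(1) Rge])
  have saR: "selfadjoint R" and saG: "selfadjoint G" using Rge G by (simp_all add: op_le_def)
  have RRi: "op_apply R (op_apply Ri x) = x" for x
    by (simp add: Ri_def op_apply_op_inv[OF invR])
  obtain k where k: "0 < k" "\<And>x. norm (op_apply R x) \<le> k * norm x"
    using op_apply_norm_bound[of R] by blast
  \<comment> \<open>Since R Y = G R, the lower bounds on G and R pass to Y at the cost of the norm
    bound k of R.\<close>
  have Yge: "(1 / k * g * sqrt q) * norm x \<le> norm (op_apply Y x)" for x
  proof -
    have "(1 / k * g * sqrt q) * norm x = (1 / k) * (g * (sqrt q * norm x))" by simp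
    also have "\<dots> \<le> (1 / k) * (g * norm (op_apply R x))"
      using k(1) G(1) norm_ge_of_op_ge[OF Rge, of x] by (intro mult_left_mono) auto
    also have "\<dots> \<le> (1 / k) * norm (op_apply G (op_apply R x))"
      using k(1) norm_ge_of_op_ge[OF G(2), of "op_apply R x"] by (intro mult_left_mono) auto
    also have "\<dots> \<le> norm (op_apply Y x)"
      using k(1) k(2)[of "op_apply Y x"] by (simp add: Y_def RRi field_simps)
    finally show ?thesis .
  qed
  have abs: "(op_abs Y)\<^sup>2 = op_adj Y * Y"
    by (rule op_abs_power2[OF _ Yge]) (use k G sq in simp)
  have posQ: "positive_op Q" using positive_op_of_ge[OF Q(2)] Q(1) by simp
  have "R * P * R - (op_abs Y)\<^sup>2 \<preceq> (((s / 2)\<^sup>2 - t) * n\<^sup>2) *\<^sub>R 1"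
    unfolding abs
  proof (rule op_le_scaleR_oneI)
    show "selfadjoint (R * P * R - op_adj Y * Y)" by (intro selfadjoint_intros saR P)
    fix x
    \<comment> \<open>Here v = R y because R R = Q; this turns the remainder into a multiple of ||Q
      x||^2 <= n^2 ||x||^2.\<close>
    let ?y = "op_apply R x" and ?u = "op_apply Y x" and ?v = "op_apply Q x"
    have Ry: "op_apply R ?y = ?v" using RR by (metis op_apply_times)
    have "qform G ?y = Re (cinner (op_apply R ?u) ?y)" by (simp add: Y_def RRi)
    then have Gy: "qform G ?y = Re (cinner ?u ?v)" by (simp add: selfadjointD[OF saR] Ry)
    have Qy: "qform Q ?y = (norm ?v)\<^sup>2"
      unfolding RR[symmetric] qform_square[OF saR] by (simp add: Ry RR)
    have "0 \<le> (norm (?u - (s / 2) *\<^sub>R ?v))\<^sup>2" by simp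
    then have "s * Re (cinner ?u ?v) \<le> (norm ?u)\<^sup>2 + (s / 2)\<^sup>2 * (norm ?v)\<^sup>2"
      unfolding norm_diff_power2 norm_scaleR power_mult_distrib
      by (simp add: cinner_scaleR_right power_divide)
    then have "qform P ?y - (norm ?u)\<^sup>2 \<le> ((s / 2)\<^sup>2 - t) * (norm ?v)\<^sup>2"
      using le[of ?y] unfolding Gy Qy by (simp add: left_diff_distrib)
    also have "\<dots> \<le> ((s / 2)\<^sup>2 - t) * (n * norm x)\<^sup>2"
      using st norm_le_of_op_le[OF posQ Q(3,4)] by (intro mult_left_mono power_mono) auto
    finally show "qform (R * P * R - op_adj Y * Y) x \<le> ((s / 2)\<^sup>2 - t) * n\<^sup>2 * (norm x)\<^sup>2"
      unfolding qform_diff qform_sandwich[OF saR] qform_op_adj_times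
      by (simp add: power_mult_distrib mult_ac)
  qed
  then show ?thesis unfolding Y_def Ri_def R_def .
qed

section \<open>Monotonicity of positive linear maps and the two inequalities\<close>

lemma clinear_scaleR: "clinear \<Phi> \<Longrightarrow> \<Phi> (r *\<^sub>R A) = r *\<^sub>R \<Phi> A"
  by (metis clinear_def scaleC_of_real)

lemma clinear_add: "clinear \<Phi> \<Longrightarrow> \<Phi> (A + B) = \<Phi> A + \<Phi> B"
  by (simp add: clinear_def)

text \<open>Positivity of \<open>A\<close> makes \<open>\<Phi> A\<close> self-adjoint directly from
  \<open>positive_map\<close>; then so is \<open>\<Phi> B\<close> =
  \<open>\<Phi> A + \<Phi> (B - A)\<close>, as the order demands.\<close>

lemma positive_map_mono:
  fixes \<Phi> :: "'h::complex_hilbert bounded_op \<Rightarrow> 'k::complex_hilbert bounded_op"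
  assumes lin: "clinear \<Phi>" and \<Phi>: "positive_map \<Phi>" and A: "positive_op A" and le: "A \<preceq> B"
  shows "\<Phi> A \<preceq> \<Phi> B"
proof -
  have sa: "selfadjoint A" "selfadjoint B" using le by (simp_all add: op_le_def)
  have "positive_op (\<Phi> (B - A))" using le \<Phi> by (simp add: op_le_iff_diff[OF sa] positive_map_def)
  moreover have B: "\<Phi> B = \<Phi> A + \<Phi> (B - A)" using clinear_add[OF lin, of A "B - A"] by simp
  moreover have "selfadjoint (\<Phi> A)" using A \<Phi> by (simp add: positive_map_def positive_op_selfadjoint)
  ultimately show ?thesis
    by (intro op_leI) (simp_all add: positive_op_iff selfadjoint_add cinner_add_left)
qed

theorem theorem5p1:
  fixes \<Phi> :: "'h::complex_hilbert bounded_op \<Rightarrow> 'k::complex_hilbert bounded_op"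
    and A B :: "'h bounded_op"
    and m1 M1 m2 M2 :: real
  assumes "clinear \<Phi>" and "positive_map \<Phi>"
    and "invertible_op (\<Phi> 1)" and "\<Phi> 1 \<preceq> 1"
    and "positive_op A" and "invertible_op A"
    and "positive_op B" and "invertible_op B"
    and "0 < m1" and "m1 \<le> M1" and "m1 *\<^sub>R 1 \<preceq> A" and "A \<preceq> M1 *\<^sub>R 1"
    and "0 < m2" and "m2 \<le> M2" and "m2 *\<^sub>R 1 \<preceq> B" and "B \<preceq> M2 *\<^sub>R 1"
  shows "op_sqrt (\<Phi> (B\<^sup>2)) * \<Phi> (A\<^sup>2) * op_sqrt (\<Phi> (B\<^sup>2))
           - (op_abs (op_inv (op_sqrt (\<Phi> (B\<^sup>2))) * \<Phi> (A\<^sup>2 \<sharp> B\<^sup>2) * op_sqrt (\<Phi> (B\<^sup>2))))\<^sup>2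
         \<preceq> ((M1 * M2 - m1 * m2)\<^sup>2 / 4 * (M2\<^sup>2 / m2\<^sup>2)) *\<^sub>R 1
       \<and> op_sqrt (\<Phi> (A\<^sup>2)) * \<Phi> (B\<^sup>2) * op_sqrt (\<Phi> (A\<^sup>2))
           - (op_abs (op_inv (op_sqrt (\<Phi> (A\<^sup>2))) * \<Phi> (A\<^sup>2 \<sharp> B\<^sup>2) * op_sqrt (\<Phi> (A\<^sup>2))))\<^sup>2
         \<preceq> ((M1 * M2 - m1 * m2)\<^sup>2 / 4 * (M1\<^sup>2 / m1\<^sup>2)) *\<^sub>R 1"
proof -
  note lin = \<open>clinear \<Phi>\<close> and \<Phi> = \<open>positive_map \<Phi>\<close> and A = \<open>m1 *\<^sub>R 1 \<preceq> A\<close> \<open>A \<preceq> M1 *\<^sub>R 1\<close>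
    and B = \<open>m2 *\<^sub>R 1 \<preceq> B\<close> \<open>B \<preceq> M2 *\<^sub>R 1\<close> and m = \<open>0 < m1\<close> \<open>m1 \<le> M1\<close> \<open>0 < m2\<close> \<open>m2 \<le> M2\<close>
  have M: "0 < M1" "0 < M2" using m by simp_all
  have saA: "selfadjoint A" "selfadjoint B" using A B by (simp_all add: op_le_def)
  let ?P = "\<Phi> (A\<^sup>2)" and ?Q = "\<Phi> (B\<^sup>2)" and ?G = "\<Phi> (A\<^sup>2 \<sharp> B\<^sup>2)"
  have pos: "positive_op (A\<^sup>2)" "positive_op (B\<^sup>2)" using saA by (simp_all add: positive_op_power2)
  have sa: "selfadjoint ?P" "selfadjoint ?Q"
    using pos \<Phi> by (simp_all add: positive_map_def positive_op_selfadjoint)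
  have pos1: "positive_op (1 :: 'h bounded_op)"
    by (simp add: positive_op_iff selfadjoint_one Re_cinner_self)
  then have "positive_op (\<Phi> 1)" using \<Phi> by (simp add: positive_map_def)
  then obtain c where c: "0 < c" "c *\<^sub>R 1 \<preceq> \<Phi> 1"
    using positive_invertible_ge \<open>invertible_op (\<Phi> 1)\<close> by blast
  \<comment> \<open>Invertibility of \<open>\<Phi> 1\<close> enters here, through c. These lower
    bounds give meaning to the roots, inverses and moduli; c does not appear in the final
    estimate.\<close>
  have ge: "(r * c) *\<^sub>R 1 \<preceq> \<Phi> T" if T: "r *\<^sub>R 1 \<preceq> T" and r: "0 < r" for r T
  proof -
    have "positive_op (r *\<^sub>R (1 :: 'h bounded_op))"
      using r by (simp add: positive_op_iff selfadjoint_intros cinner_scaleR_left Re_cinner_self)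
    then have le: "r *\<^sub>R \<Phi> 1 \<preceq> \<Phi> T"
      using positive_map_mono[OF lin \<Phi> _ T] by (simp add: clinear_scaleR[OF lin])
    show ?thesis
    proof (rule op_le_scaleR_oneI)
      show "selfadjoint (\<Phi> T)" using le by (simp add: op_le_def)
      fix x
      have "r * (c * (norm x)\<^sup>2) \<le> r * qform (\<Phi> 1) x"
        using scaleR_one_op_leD[OF c(2), of x] r by simp
      also have "\<dots> \<le> qform (\<Phi> T) x" using op_leD[OF le, of x] unfolding qform_simps .
      finally show "r * c * (norm x)\<^sup>2 \<le> qform (\<Phi> T) x" by (simp add: mult.assoc)
    qed
  qed
  \<comment> \<open>Here \<open>\<Phi> 1 \<preceq> 1\<close> carries scalar upper bounds over
    unchanged.\<close>
  have le: "\<Phi> T \<preceq> r *\<^sub>R 1" if T: "positive_op T" "T \<preceq> r *\<^sub>R 1" and r: "0 < r" for r T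
  proof -
    have le: "\<Phi> T \<preceq> r *\<^sub>R \<Phi> 1"
      using positive_map_mono[OF lin \<Phi> T] by (simp add: clinear_scaleR[OF lin])
    show ?thesis
    proof (rule op_le_scaleR_oneI)
      show "selfadjoint (\<Phi> T)" using le by (simp add: op_le_def)
      fix x
      have "qform (\<Phi> T) x \<le> r * qform (\<Phi> 1) x" using op_leD[OF le, of x] unfolding qform_simps .
      also have "\<dots> \<le> r * (norm x)\<^sup>2"
        using op_leD[OF \<open>\<Phi> 1 \<preceq> 1\<close>, of x] r unfolding qform_simps by simp
      finally show "qform (\<Phi> T) x \<le> r * (norm x)\<^sup>2" .
    qed
  qed
  have posAB: "positive_op A" "positive_op B" by fact+
  have A2: "(m1\<^sup>2 * c) *\<^sub>R 1 \<preceq> ?P" "?P \<preceq> M1\<^sup>2 *\<^sub>R 1" "0 < m1\<^sup>2 * c"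
    using ge[OF power2_ge[OF A(1)]] le[OF pos(1) power2_le[OF posAB(1) A(2)]] m M c by simp_all
  have B2: "(m2\<^sup>2 * c) *\<^sub>R 1 \<preceq> ?Q" "?Q \<preceq> M2\<^sup>2 *\<^sub>R 1" "0 < m2\<^sup>2 * c"
    using ge[OF power2_ge[OF B(1)]] le[OF pos(2) power2_le[OF posAB(2) B(2)]] m M c by simp_all
  have G: "(m2 / M1 * m1\<^sup>2 * c) *\<^sub>R 1 \<preceq> ?G" "0 < m2 / M1 * m1\<^sup>2 * c"
    using ge[OF op_mean_power2_ge[OF m A B]] m M c by simp_all
  have "positive_op ((m1 * M1) *\<^sub>R B\<^sup>2 + (m2 * M2) *\<^sub>R A\<^sup>2)"
    using pos m M unfolding positive_op_iff qform_simps
    by (auto intro!: selfadjoint_intros saA)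
  from positive_map_mono[OF lin \<Phi> this diaz_metcalf[OF m A B]]
  have "(m1 * M1) *\<^sub>R ?Q + (m2 * M2) *\<^sub>R ?P \<preceq> (m1 * m2 + M1 * M2) *\<^sub>R ?G"
    by (simp add: clinear_scaleR[OF lin] clinear_add[OF lin])
  then have dm: "m1 * M1 * qform ?Q x + m2 * M2 * qform ?P x \<le> (m1 * m2 + M1 * M2) * qform ?G x" for x
    unfolding qform_simps[symmetric] by (rule op_leD)
  have gap: "(m1 * m2 + M1 * M2)\<^sup>2 - 4 * (m1 * M1) * (m2 * M2) = (M1 * M2 - m1 * m2)\<^sup>2"
    by (simp add: power2_eq_square algebra_simps)
  \<comment> \<open>p is the coefficient of the form to be isolated and q the other one. As p q is
    the same for both claims, (s/2)^2 - t has the same numerator (M1 M2 - m1 m2)^2 in each.\<close>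
  have coeff: "((m1 * m2 + M1 * M2) / p / 2)\<^sup>2 - q / p = (M1 * M2 - m1 * m2)\<^sup>2 / (4 * p\<^sup>2)"
    if "p * q = (m1 * M1) * (m2 * M2)" "0 < p" for p q
    unfolding gap[symmetric] using that by (simp add: field_simps power2_eq_square)
  have divide: "u \<le> d / p * v - q / p * w" if "q * w + p * u \<le> d * v" "0 < p" for p q d u v w :: real
    using that by (simp add: field_simps)
  show ?thesis
  proof
    \<comment> \<open>Dividing the Diaz-Metcalf inequality by m2 M2 isolates the form of
      \<open>\<Phi> (A\<^sup>2)\<close>. The final constant arises from M2^4 / (m2 M2)^2 = M2^2 /
      m2^2.\<close>
    let ?s = "(m1 * m2 + M1 * M2) / (m2 * M2)" and ?t = "m1 * M1 / (m2 * M2)"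
    have k: "(?s / 2)\<^sup>2 - ?t = (M1 * M2 - m1 * m2)\<^sup>2 / (4 * (m2 * M2)\<^sup>2)"
      by (rule coeff) (use m M in simp_all)
    have "qform ?P x \<le> ?s * qform ?G x - ?t * qform ?Q x" for x
      by (rule divide[OF dm]) (use m M in simp)
    moreover have "?t \<le> (?s / 2)\<^sup>2"
    proof -
      have "0 \<le> (?s / 2)\<^sup>2 - ?t" unfolding k by simp
      then show ?thesis by simp
    qed
    ultimately have "op_sqrt ?Q * ?P * op_sqrt ?Q - (op_abs (op_inv (op_sqrt ?Q) * ?G * op_sqrt ?Q))\<^sup>2
        \<preceq> (((?s / 2)\<^sup>2 - ?t) * (M2\<^sup>2)\<^sup>2) *\<^sub>R 1"
      by (intro sandwich_minus_op_abs_le[OF B2(3,1,2) _ G(2,1) sa(1)]) simp_all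
    moreover have "((?s / 2)\<^sup>2 - ?t) * (M2\<^sup>2)\<^sup>2 = (M1 * M2 - m1 * m2)\<^sup>2 / 4 * (M2\<^sup>2 / m2\<^sup>2)"
      unfolding k using m M by (simp add: power_mult_distrib field_simps power2_eq_square)
    ultimately show "op_sqrt ?Q * ?P * op_sqrt ?Q - (op_abs (op_inv (op_sqrt ?Q) * ?G * op_sqrt ?Q))\<^sup>2
        \<preceq> ((M1 * M2 - m1 * m2)\<^sup>2 / 4 * (M2\<^sup>2 / m2\<^sup>2)) *\<^sub>R 1" by simp
  next
    \<comment> \<open>The same inequality divided by m1 M1, now isolating
      \<open>\<Phi> (B\<^sup>2)\<close>.\<close>
    let ?s = "(m1 * m2 + M1 * M2) / (m1 * M1)" and ?t = "m2 * M2 / (m1 * M1)"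
    have k: "(?s / 2)\<^sup>2 - ?t = (M1 * M2 - m1 * m2)\<^sup>2 / (4 * (m1 * M1)\<^sup>2)"
      by (rule coeff) (use m M in simp_all)
    have "qform ?Q x \<le> ?s * qform ?G x - ?t * qform ?P x" for x
      by (rule divide[OF dm[unfolded add.commute[of "m1 * M1 * _"]]]) (use m M in simp)
    moreover have "?t \<le> (?s / 2)\<^sup>2"
    proof -
      have "0 \<le> (?s / 2)\<^sup>2 - ?t" unfolding k by simp
      then show ?thesis by simp
    qed
    ultimately have "op_sqrt ?P * ?Q * op_sqrt ?P - (op_abs (op_inv (op_sqrt ?P) * ?G * op_sqrt ?P))\<^sup>2
        \<preceq> (((?s / 2)\<^sup>2 - ?t) * (M1\<^sup>2)\<^sup>2) *\<^sub>R 1"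
      by (intro sandwich_minus_op_abs_le[OF A2(3,1,2) _ G(2,1) sa(2)]) simp_all
    moreover have "((?s / 2)\<^sup>2 - ?t) * (M1\<^sup>2)\<^sup>2 = (M1 * M2 - m1 * m2)\<^sup>2 / 4 * (M1\<^sup>2 / m1\<^sup>2)"
      unfolding k using m M by (simp add: power_mult_distrib field_simps power2_eq_square)
    ultimately show "op_sqrt ?P * ?Q * op_sqrt ?P - (op_abs (op_inv (op_sqrt ?P) * ?G * op_sqrt ?P))\<^sup>2
        \<preceq> ((M1 * M2 - m1 * m2)\<^sup>2 / 4 * (M1\<^sup>2 / m1\<^sup>2)) *\<^sub>R 1" by simp
  qed
qed

end
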